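(* Let $X$ be a Euclidean space, let $I$ be a nonempty finite set, let $\mathcal{F}=\{f_i\}_{i\in I}$ be a compatible system of proper convex functions from $X$ to $]-\infty,+\infty]$, and let $f:=\min_{i\in I}f_i$. Assume that there exists $x\in\operatorname{ri}D_f$ such that $\bigcap_{i\in I(x)}\partial f_i(x)=\varnothing$. Then $f$ is not convex.
   Context: $X$ is a (finite-dimensional) Euclidean space with inner product $\langle\cdot,\cdot\rangle$. For $g\colon X\to\,]-\infty,+\infty]$, the domain is $D_g:=\{x\in X: g(x)<+\infty\}$, and $g$ is proper if $D_g\neq\varnothing$. For proper $g$, the subdifferential $\partial g(x)$ is the set of all $x^*\in X$ with $\langle x^*,y-x\rangle\leq g(y)-g(x)$ for all $y\in X$ (it is empty when $x\notin D_g$). $\operatorname{ri}$ denotes relative interior (interior relative to the affine hull). Note $D_f=\bigcup_{i\in I}D_{f_i}$. Active index set: $I(x):=\{i\in I: x\in D_{f_i}\}$. Compatible system of functions: $\mathcal{F}=\{f_i\}_{i\in I}$ is compatible if each restriction $f_i|_{D_{f_i}}$ is continuous and, for all $i\neq j$ in $I$, $f_i$ and $f_j$ coincide on $D_{f_i}\cap D_{f_j}$. *)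

theory Defs
  imports "HOL-Analysis.Analysis"
begin

definition eff_domain :: "('a \<Rightarrow> ereal) \<Rightarrow> 'a set"
  where "eff_domain g = {x. g x < \<infinity>}"

text \<open>Functions into \<open>]-\<infinity>, +\<infinity>]\<close> are rendered as \<open>ereal\<close>-valued functions that omit
  the value \<open>-\<infinity>\<close>; this is made part of properness.\<close>

definition proper_fun :: "('a \<Rightarrow> ereal) \<Rightarrow> bool"
  where "proper_fun g \<longleftrightarrow> (\<forall>x. g x \<noteq> -\<infinity>) \<and> eff_domain g \<noteq> {}"

text \<open>The library's \<open>convex_on\<close> covers real-valued functions only.\<close>

definition convex_fun :: "('a::real_vector \<Rightarrow> ereal) \<Rightarrow> bool"
  where "convex_fun g \<longleftrightarrow>
    (\<forall>x y t. 0 < t \<longrightarrow> t < 1 \<longrightarrow>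
      g ((1 - t) *\<^sub>R x + t *\<^sub>R y) \<le> ereal (1 - t) * g x + ereal t * g y)"

text \<open>On \<open>ereal\<close>, \<open>\<infinity> - \<infinity> = \<infinity>\<close> and \<open>r - \<infinity> = -\<infinity>\<close> for real \<open>r\<close>, so for proper \<open>g\<close>
  the defining inequality fails at every point outside the domain.\<close>

definition subdifferential :: "('a::real_inner \<Rightarrow> ereal) \<Rightarrow> 'a \<Rightarrow> 'a set"
  where "subdifferential g x = {v. \<forall>y. ereal (v \<bullet> (y - x)) \<le> g y - g x}"

definition active_index :: "('i \<Rightarrow> 'a \<Rightarrow> ereal) \<Rightarrow> 'i set \<Rightarrow> 'a \<Rightarrow> 'i set"
  where "active_index F I x = {i \<in> I. x \<in> eff_domain (F i)}"

definition compatible_system ::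
    "('i \<Rightarrow> 'a::topological_space \<Rightarrow> ereal) \<Rightarrow> 'i set \<Rightarrow> bool"
  where "compatible_system F I \<longleftrightarrow>
    (\<forall>i\<in>I. continuous_on (eff_domain (F i)) (F i)) \<and>
    (\<forall>i\<in>I. \<forall>j\<in>I. i \<noteq> j \<longrightarrow>
      (\<forall>x \<in> eff_domain (F i) \<inter> eff_domain (F j). F i x = F j x))"

lemma subdifferential_outside_domain:
  assumes "proper_fun g" "x \<notin> eff_domain g"
  shows "subdifferential g x = {}"
proof -
  obtain y where y: "g y < \<infinity>" "g y \<noteq> -\<infinity>"
    using assms(1) by (auto simp: proper_fun_def eff_domain_def)
  have "g x = \<infinity>" using assms(2) by (auto simp: eff_domain_def)
  with y have "g y - g x = -\<infinity>" by (cases "g y") auto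
  then have "\<not> ereal (v \<bullet> (y - x)) \<le> g y - g x" for v by simp
  then show ?thesis unfolding subdifferential_def by blast
qed

lemma convex_fun_iff_convex_on:
  fixes g :: "'a::real_vector \<Rightarrow> ereal"
  assumes ninf: "\<And>x. g x \<noteq> -\<infinity>"
  shows "convex_fun g \<longleftrightarrow> convex_on (eff_domain g) (\<lambda>x. real_of_ereal (g x))"
proof -
  let ?D = "eff_domain g" and ?r = "\<lambda>x. real_of_ereal (g x)"
  have fin: "g x = ereal (?r x)" if "x \<in> ?D" for x
    using that ninf[of x] by (cases "g x") (auto simp: eff_domain_def)
  have inf: "g x = \<infinity>" if "x \<notin> ?D" for x
    using that by (auto simp: eff_domain_def)
  show ?thesis
  proof
    assume cv: "convex_fun g"
    have key: "(1 - t) *\<^sub>R x + t *\<^sub>R y \<in> ?D \<and>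
        ?r ((1 - t) *\<^sub>R x + t *\<^sub>R y) \<le> (1 - t) * ?r x + t * ?r y"
      if xy: "x \<in> ?D" "y \<in> ?D" and t: "0 < t" "t < 1" for x y t
    proof -
      let ?z = "(1 - t) *\<^sub>R x + t *\<^sub>R y"
      have "g ?z \<le> ereal (1 - t) * g x + ereal t * g y"
        using cv t unfolding convex_fun_def by blast
      also have "\<dots> = ereal ((1 - t) * ?r x + t * ?r y)"
        by (subst fin[OF xy(1)], subst fin[OF xy(2)]) simp
      finally have le: "g ?z \<le> ereal ((1 - t) * ?r x + t * ?r y)" .
      then have "g ?z < \<infinity>" by (rule order_le_less_trans) simp
      then have "?z \<in> ?D" by (simp add: eff_domain_def)
      with le fin show ?thesis by (metis ereal_less_eq(3))
    qed
    have "convex ?D"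
      unfolding convex_alt
    proof (intro ballI allI impI)
      fix x y :: 'a and t :: real
      assume *: "x \<in> ?D" "y \<in> ?D" "0 \<le> t \<and> t \<le> 1"
      then consider "t = 0" | "t = 1" | "0 < t" "t < 1" by linarith
      then show "(1 - t) *\<^sub>R x + t *\<^sub>R y \<in> ?D"
        using * key by cases auto
    qed
    then show "convex_on ?D ?r"
      using key by (intro convex_onI) auto
  next
    assume cv: "convex_on ?D ?r"
    show "convex_fun g"
      unfolding convex_fun_def
    proof (intro allI impI)
      fix x y :: 'a and t :: real
      assume t: "0 < t" "t < 1"
      let ?z = "(1 - t) *\<^sub>R x + t *\<^sub>R y"
      show "g ?z \<le> ereal (1 - t) * g x + ereal t * g y"
      proof (cases "x \<in> ?D \<and> y \<in> ?D")
        case True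
        then have z: "?z \<in> ?D"
          using cv t unfolding convex_on_def convex_alt by simp
        have "?r ?z \<le> (1 - t) * ?r x + t * ?r y"
          using cv t True by (intro convex_onD) auto
        then have "g ?z \<le> ereal ((1 - t) * ?r x + t * ?r y)"
          using fin[OF z] by (metis ereal_less_eq(3))
        also have "\<dots> = ereal (1 - t) * g x + ereal t * g y"
          using True fin by (metis plus_ereal.simps(1) times_ereal.simps(1))
        finally show ?thesis .
      next
        case False
        then have "g x = \<infinity> \<or> g y = \<infinity>" using inf by blast
        then show ?thesis using t ninf[of x] ninf[of y] by auto
      qed
    qed
  qed
qed

end

theory Submission
  imports Defs
begin

text \<open>If \<open>f\<close> were convex, it would have a subgradient at every point \<open>x\<close> of the relative
  interior of its domain, namely the slope of a hyperplane supporting the epigraph at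
  \<open>(x, f x)\<close>. By compatibility \<open>f\<close> agrees at \<open>x\<close> with every active \<open>f\<^sub>i\<close>, while \<open>f\<close> is below
  each \<open>f\<^sub>i\<close> everywhere, so this subgradient is common to all active \<open>f\<^sub>i\<close>.\<close>

text \<open>A hyperplane with normal \<open>(u, s)\<close> supports the epigraph at
  \<open>(x, r x)\<close>. Since \<open>x\<close> is in the relative interior of \<open>D\<close>,
  it cannot be vertical, so \<open>s > 0\<close> and the normal can be rescaled to yield a
  slope.\<close>

lemma convex_on_subgradient_rel_interior:
  fixes r :: "'a::euclidean_space \<Rightarrow> real"
  assumes cv: "convex_on D r" and x: "x \<in> rel_interior D"
  obtains v where "\<And>y. y \<in> D \<Longrightarrow> v \<bullet> (y - x) \<le> r y - r x"
proof -
  let ?E = "epigraph D r"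
  have cD: "convex D" using cv by (rule convex_on_imp_convex)
  have cE: "convex ?E" using cv by (simp add: convex_epigraph cD)
  have xD: "x \<in> D" using x rel_interior_subset by blast
  have xE: "(x, r x) \<in> ?E" using xD by (simp add: epigraph_def)
  \<comment> \<open>Otherwise the segment from \<open>(x, r x + 1)\<close> to
    \<open>(x, r x)\<close> could be prolonged within the epigraph, to a point strictly below the
    graph.\<close>
  have "(x, r x) \<notin> rel_interior ?E"
  proof
    assume "(x, r x) \<in> rel_interior ?E"
    moreover have "(x, r x + 1) \<in> ?E" using xD by (simp add: epigraph_def)
    ultimately obtain e where e: "e > 1" "(1 - e) *\<^sub>R (x, r x + 1) + e *\<^sub>R (x, r x) \<in> ?E"
      using convex_rel_interior_iff[OF cE] xE by blast
    moreover have "(1 - e) *\<^sub>R x + e *\<^sub>R x = x" by (simp flip: scaleR_add_left)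
    ultimately show False by (simp add: epigraph_def algebra_simps)
  qed
  then obtain a where a: "\<And>p. p \<in> ?E \<Longrightarrow> a \<bullet> (x, r x) \<le> a \<bullet> p"
      "\<And>p. p \<in> rel_interior ?E \<Longrightarrow> a \<bullet> (x, r x) < a \<bullet> p"
    using supporting_hyperplane_rel_boundary[OF cE xE] by metis
  obtain u s where us: "a = (u, s)" by fastforce
  have le: "u \<bullet> x + s * r x \<le> u \<bullet> y + s * t" if "y \<in> D" "r y \<le> t" for y t
    using a(1)[of "(y, t)"] that by (simp add: us epigraph_def)
  \<comment> \<open>The epigraph is unbounded upwards, so the normal cannot point down.\<close>
  have "s \<ge> 0" using le[OF xD, of "r x + 1"] by (simp add: algebra_simps)
  \<comment> \<open>If \<open>s = 0\<close>, then \<open>x\<close> minimizes the inner product with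
    \<open>u\<close> over \<open>D\<close>. Prolonging the segment from \<open>y\<close> to
    \<open>x\<close> slightly beyond \<open>x\<close> stays in \<open>D\<close> and gives
    \<open>u \<bullet> y \<le> u \<bullet> x\<close>, against the strict inequality at relative
    interior points of the epigraph.\<close>
  moreover have "s \<noteq> 0"
  proof
    assume s: "s = 0"
    obtain y t where yt: "(y, t) \<in> rel_interior ?E"
      using rel_interior_eq_empty[OF cE] xE by fastforce
    then have "y \<in> D" using rel_interior_subset[of ?E] by (auto simp: epigraph_def)
    then obtain e where e: "e > 1" "(1 - e) *\<^sub>R y + e *\<^sub>R x \<in> D"
      using convex_rel_interior_iff[OF cD] x xD by blast
    have "u \<bullet> x \<le> u \<bullet> ((1 - e) *\<^sub>R y + e *\<^sub>R x)"
      using le[OF e(2) order_refl] s by simp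
    then have "(e - 1) * (u \<bullet> y) \<le> (e - 1) * (u \<bullet> x)"
      by (simp add: algebra_simps)
    then have "u \<bullet> y \<le> u \<bullet> x" using e(1) by simp
    moreover have "u \<bullet> x < u \<bullet> y" using a(2)[OF yt] s by (simp add: us)
    ultimately show False by simp
  qed
  ultimately have s: "s > 0" by simp
  \<comment> \<open>Dividing the supporting inequality at \<open>(y, r y)\<close> by
    \<open>s\<close> shows that \<open>- (1 / s) *\<^sub>R u\<close> is a subgradient.\<close>
  show thesis
  proof (rule that)
    fix y assume "y \<in> D"
    from le[OF this order_refl] s
    show "(- (1 / s) *\<^sub>R u) \<bullet> (y - x) \<le> r y - r x"
      by (simp add: inner_diff_right field_simps)
  qed
qed

text \<open>The real-valued subgradient on the domain also serves outside it, where the right-hand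
  side is \<infinity>.\<close>

lemma subdifferential_rel_interior_nonempty:
  fixes g :: "'a::euclidean_space \<Rightarrow> ereal"
  assumes ninf: "\<And>x. g x \<noteq> -\<infinity>" and cv: "convex_fun g"
    and x: "x \<in> rel_interior (eff_domain g)"
  shows "subdifferential g x \<noteq> {}"
proof -
  have fin: "g y = ereal (real_of_ereal (g y))" if "y \<in> eff_domain g" for y
    using that ninf[of y] by (cases "g y") (auto simp: eff_domain_def)
  obtain v where v: "\<And>y. y \<in> eff_domain g \<Longrightarrow>
      v \<bullet> (y - x) \<le> real_of_ereal (g y) - real_of_ereal (g x)"
    using convex_on_subgradient_rel_interior[OF iffD1[OF convex_fun_iff_convex_on[OF ninf] cv] x]
    by blast
  have xD: "x \<in> eff_domain g" using x rel_interior_subset by blast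
  have "ereal (v \<bullet> (y - x)) \<le> g y - g x" for y
  proof (cases "y \<in> eff_domain g")
    case True
    show ?thesis
      using v[OF True] by (subst fin[OF True], subst fin[OF xD]) simp
  next
    case False
    then have "g y = \<infinity>" by (simp add: eff_domain_def)
    then show ?thesis by simp
  qed
  then show ?thesis by (auto simp: subdifferential_def)
qed

text \<open>Passing from \<open>f\<close> to \<open>g\<close> can only raise the value at
  \<open>y\<close> and keeps the one at \<open>x\<close>, so each subgradient inequality is
  weakened.\<close>

lemma subdifferential_mono_at_contact:
  assumes "\<And>y. f y \<le> g y" and "f x = g x"
  shows "subdifferential f x \<subseteq> subdifferential g x"
  unfolding subdifferential_def
  using assms by (auto intro: order_trans[OF _ ereal_minus_mono[OF _ order_refl]])

theorem theorem7p1: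
  fixes F :: "'i \<Rightarrow> 'a::euclidean_space \<Rightarrow> ereal"
    and I :: "'i set"
    and f :: "'a \<Rightarrow> ereal"
  assumes "finite I" and "I \<noteq> {}"
    and "\<And>i. i \<in> I \<Longrightarrow> proper_fun (F i)"
    and "\<And>i. i \<in> I \<Longrightarrow> convex_fun (F i)"
    and "compatible_system F I"
    and "f = (\<lambda>x. MIN i\<in>I. F i x)"
    and "\<exists>x \<in> rel_interior (eff_domain f).
           (\<Inter>i \<in> active_index F I x. subdifferential (F i) x) = {}"
  shows "\<not> convex_fun f"
proof
  assume cv: "convex_fun f"
  obtain x where x: "x \<in> rel_interior (eff_domain f)"
    and empty: "(\<Inter>i \<in> active_index F I x. subdifferential (F i) x) = {}"
    using assms(7) by blast
  have le: "f y \<le> F i y" if "i \<in> I" for i y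
    using that assms(1) by (simp add: assms(6))
  have att: "\<exists>i\<in>I. f y = F i y" for y
  proof -
    have "f y \<in> (\<lambda>i. F i y) ` I"
      unfolding assms(6) using assms(1,2) by (intro Min_in) auto
    then show ?thesis by blast
  qed
  have "f y \<noteq> -\<infinity>" for y
    using att[of y] assms(3) unfolding proper_fun_def by metis
  then obtain v where v: "v \<in> subdifferential f x"
    using subdifferential_rel_interior_nonempty[OF _ cv x] by blast
  have "v \<in> subdifferential (F i) x" if i: "i \<in> active_index F I x" for i
  proof -
    have iI: "i \<in> I" and ix: "x \<in> eff_domain (F i)"
      using i by (auto simp: active_index_def)
    obtain j where j: "j \<in> I" "f x = F j x" using att by blast
    \<comment> \<open>The index \<open>j\<close> attaining the minimum is active too, because
      \<open>f x \<le> F i x < \<infinity>\<close>; only then does compatibility equate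
      \<open>F j x\<close> and \<open>F i x\<close>.\<close>
    have "x \<in> eff_domain (F j)"
      using order_le_less_trans[OF le[OF iI, of x], of \<infinity>] ix
      by (simp add: eff_domain_def flip: j(2))
    then have "F j x = F i x"
      using assms(5) iI ix j(1) unfolding compatible_system_def by (metis IntI)
    then have "f x = F i x" using j(2) by simp
    then show ?thesis
      using subdifferential_mono_at_contact[of f "F i" x] le[OF iI] v by blast
  qed
  with empty show False by blast
qed

end
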